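(* Let $\mathfrak{F}$ be a saturated formation of finite groups containing the class $\mathfrak{U}$ of all finite supersoluble groups. Let $G$ be a finite group and $H$ a normal subgroup of $G$ such that $G/H\in\mathfrak{F}$ and $\Phi(G)\cap H\leq\Phi(H)$. If, for every maximal subgroup $M$ of $G$, the index $|\tilde{\mathrm{F}}(H):\tilde{\mathrm{F}}(H)\cap M|$ is equal to $1$ or to a prime, then $G\in\mathfrak{F}$.
   Context: All groups are finite. $\Phi(X)$ denotes the Frattini subgroup of a group $X$. A formation is a class of groups closed under homomorphic images and such that if $G/N_1$ and $G/N_2$ lie in it then so does $G/(N_1\cap N_2)$; it is saturated if $G/\Phi(G)\in\mathfrak{F}$ implies $G\in\mathfrak{F}$. For a group $X$, $\tilde{\mathrm{F}}(X)$ denotes the subgroup of $X$ containing $\Phi(X)$ defined by $\tilde{\mathrm{F}}(X)/\Phi(X)=\mathrm{Soc}(X/\Phi(X))$, the socle (product of all minimal normal subgroups) of $X/\Phi(X)$. *)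

theory Defs
  imports "HOL-Algebra.Algebra"
begin

definition maximal_subgroup :: "'a set \<Rightarrow> ('a, 'b) monoid_scheme \<Rightarrow> bool" where
  "maximal_subgroup M G \<longleftrightarrow> subgroup M G \<and> M \<noteq> carrier G \<and>
     (\<forall>K. subgroup K G \<and> M \<subseteq> K \<longrightarrow> K = M \<or> K = carrier G)"

text \<open>Frattini subgroup: intersection of all maximal subgroups (the whole group if there are none).\<close>
definition frattini :: "('a, 'b) monoid_scheme \<Rightarrow> 'a set" where
  "frattini G = carrier G \<inter> \<Inter> {M. maximal_subgroup M G}"

definition minimal_normal :: "'a set \<Rightarrow> ('a, 'b) monoid_scheme \<Rightarrow> bool" where
  "minimal_normal N G \<longleftrightarrow> N \<lhd> G \<and> N \<noteq> {\<one>\<^bsub>G\<^esub>} \<and>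
     (\<forall>K. K \<lhd> G \<and> K \<subseteq> N \<longrightarrow> K = {\<one>\<^bsub>G\<^esub>} \<or> K = N)"

definition socle :: "('a, 'b) monoid_scheme \<Rightarrow> 'a set" where
  "socle G = generate G (\<Union> {N. minimal_normal N G})"

definition gen_fitting_tilde :: "('a, 'b) monoid_scheme \<Rightarrow> 'a set" where
  "gen_fitting_tilde K =
     {x \<in> carrier K. r_coset K (frattini K) x \<in> socle (K Mod frattini K)}"

definition supersoluble :: "('a, 'b) monoid_scheme \<Rightarrow> bool" where
  "supersoluble G \<longleftrightarrow> group G \<and> (\<exists>Ns :: 'a set list. Ns \<noteq> [] \<and>
     hd Ns = {\<one>\<^bsub>G\<^esub>} \<and> last Ns = carrier G \<and> (\<forall>N \<in> set Ns. N \<lhd> G) \<and>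
     (\<forall>i. Suc i < length Ns \<longrightarrow> Ns ! i \<subseteq> Ns ! Suc i \<and>
        cyclic_group ((G\<lparr>carrier := Ns ! Suc i\<rparr>) Mod (Ns ! i))))"

text \<open>A class of finite groups is represented by a predicate on groups with carrier in nat
  (every finite group has an isomorphic copy there); a group K of any type belongs to the
  class iff it is a finite group isomorphic to a member.\<close>
definition in_class :: "(nat monoid \<Rightarrow> bool) \<Rightarrow> ('a, 'b) monoid_scheme \<Rightarrow> bool" where
  "in_class F K \<longleftrightarrow> group K \<and> finite (carrier K) \<and>
     (\<exists>Y :: nat monoid. F Y \<and> group Y \<and> finite (carrier Y) \<and> K \<cong> Y)"

definition formation :: "(nat monoid \<Rightarrow> bool) \<Rightarrow> bool" where
  "formation F \<longleftrightarrow>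
    (\<forall>G :: nat monoid. \<forall>N. group G \<and> finite (carrier G) \<and> in_class F G \<and> N \<lhd> G
        \<longrightarrow> in_class F (G Mod N)) \<and>
    (\<forall>G :: nat monoid. \<forall>N1 N2. group G \<and> finite (carrier G) \<and> N1 \<lhd> G \<and> N2 \<lhd> G \<and>
        in_class F (G Mod N1) \<and> in_class F (G Mod N2) \<longrightarrow> in_class F (G Mod (N1 \<inter> N2)))"

definition saturated_formation :: "(nat monoid \<Rightarrow> bool) \<Rightarrow> bool" where
  "saturated_formation F \<longleftrightarrow> formation F \<and>
    (\<forall>G :: nat monoid. group G \<and> finite (carrier G) \<and> in_class F (G Mod frattini G)
        \<longrightarrow> in_class F G)"

end

theory Submission
  imports Defs "HOL-Computational_Algebra.Group_Closure" "HOL-Number_Theory.Residues"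
begin

text \<open>
  Factoring out \<open>\<Phi>(H)\<close>, which lies in \<open>\<Phi>(G)\<close>, we may assume by saturation that
  \<open>\<Phi>(G) \<inter> H = 1\<close>; then the subgroup of the index condition becomes the socle of \<open>H\<close>, which
  contains every minimal normal subgroup \<open>N\<close> of \<open>G\<close> inside \<open>H\<close>. A maximal subgroup \<open>M\<close> avoiding
  \<open>N\<close> satisfies \<open>NM = G\<close> and therefore has prime index \<open>p\<close>, dividing \<open>|N|\<close>. The action on its
  cosets is faithful on \<open>N\<close>, so \<open>|N|\<close> divides \<open>p!\<close>: thus \<open>p\<close> is the largest prime divisor of
  \<open>|N|\<close>, the same for all such \<open>M\<close>, and \<open>p\<^sup>2\<close> does not divide \<open>|N|\<close>. A Sylow \<open>p\<close>-subgroup \<open>Q\<close>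
  of \<open>N\<close> has order \<open>p\<close> and lies in no such \<open>M\<close>, so by the Frattini argument it is normal, and
  \<open>N = Q\<close>.
  Now \<open>L = C\<^sub>G(N) \<inter> M\<close> is normal in \<open>G\<close>, does not contain \<open>N\<close>, and \<open>C\<^sub>G(N) = NL\<close>. Since
  \<open>G/C\<^sub>G(N)\<close> embeds into the cyclic group of units modulo \<open>p\<close>, the quotient \<open>G/L\<close> is
  supersoluble. A smallest normal subgroup \<open>K \<le> H\<close> of \<open>G\<close> with \<open>G/K\<close> in the formation must be
  trivial: otherwise it contains such an \<open>N\<close>, and \<open>K \<inter> L\<close> is smaller.
\<close>

section \<open>Subgroups and homomorphisms\<close>

lemma (in group) modular_law:
  assumes "subgroup C G" and "A \<subseteq> C" and "B \<subseteq> carrier G"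
  shows "C \<inter> (A <#> B) = A <#> (C \<inter> B)"
proof
  interpret C: subgroup C G by (rule assms(1))
  show "A <#> (C \<inter> B) \<subseteq> C \<inter> (A <#> B)"
    using \<open>A \<subseteq> C\<close> by (auto simp: set_mult_def)
  show "C \<inter> (A <#> B) \<subseteq> A <#> (C \<inter> B)"
  proof clarify
    fix x assume "x \<in> C" "x \<in> A <#> B"
    then obtain a b where ab: "a \<in> A" "b \<in> B" "x = a \<otimes> b"
      by (auto simp: set_mult_def)
    then have "a \<in> C" "b = inv a \<otimes> x"
      using assms(2,3) C.mem_carrier by (auto simp: subset_iff simp flip: m_assoc)
    then have "b \<in> C \<inter> B"
      using \<open>b \<in> B\<close> \<open>x \<in> C\<close> by simp
    then show "x \<in> A <#> (C \<inter> B)"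
      using ab by (auto simp: set_mult_def)
  qed
qed

lemma (in group_hom) vimage_subgroup:
  assumes "subgroup M H"
  shows "subgroup {x \<in> carrier G. h x \<in> M} G"
proof -
  interpret M: subgroup M H by (rule assms)
  show ?thesis by (rule G.subgroupI) (auto intro!: exI[of _ \<one>])
qed

lemma image_vimage_eq:
  assumes "h ` A = B" "M \<subseteq> B"
  shows "h ` {x \<in> A. h x \<in> M} = M"
  using assms by auto

lemma (in group_hom) vimage_image_eq:
  assumes "subgroup K G" and "kernel G H h \<subseteq> K"
  shows "{x \<in> carrier G. h x \<in> h ` K} = K"
proof
  interpret K: subgroup K G by (rule assms(1))
  show "K \<subseteq> {x \<in> carrier G. h x \<in> h ` K}"
    using K.subset by auto
  show "{x \<in> carrier G. h x \<in> h ` K} \<subseteq> K"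
  proof clarify
    fix x k assume x: "x \<in> carrier G" and k: "k \<in> K" "h x = h k"
    then have "x \<otimes> inv k \<in> K"
      using assms(2) by (auto simp: kernel_def)
    then have "x \<otimes> inv k \<otimes> k \<in> K"
      using k(1) by (rule K.m_closed)
    then show "x \<in> K"
      using x k by (simp add: G.m_assoc)
  qed
qed

lemma (in group_hom) FactGroup_image_iso:
  assumes surj: "h ` carrier G = carrier H" and N: "N \<lhd> G" and ker: "kernel G H h \<subseteq> N"
  shows "h ` N \<lhd> H" and "G Mod N \<cong> H Mod h ` N"
proof -
  show image_N: "h ` N \<lhd> H"
    by (rule normal.surj_hom_normal_subgroup[OF N group_hom_axioms surj])
  interpret image_N: normal "h ` N" H by (rule image_N)
  let ?f = "\<lambda>x. h ` N #>\<^bsub>H\<^esub> h x"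
  have "?f \<in> hom G (H Mod h ` N)"
    using Group.hom_compose[OF homh image_N.r_coset_hom_Mod] by (simp add: comp_def)
  then interpret f: group_hom G "H Mod h ` N" ?f
    by (simp add: group_hom_def group_hom_axioms_def image_N.factorgroup_is_group)
  have "h ` N #>\<^bsub>H\<^esub> y = h ` N \<longleftrightarrow> y \<in> h ` N" if "y \<in> carrier H" for y
    using that H.coset_join1 H.coset_join2 image_N.subset image_N.subgroup_axioms by blast
  then have "kernel G (H Mod h ` N) ?f = {x \<in> carrier G. h x \<in> h ` N}"
    by (simp add: kernel_def cong: conj_cong)
  also have "\<dots> = N"
    using N ker by (simp add: normal_imp_subgroup vimage_image_eq)
  finally have "kernel G (H Mod h ` N) ?f = N" .
  moreover have "?f ` carrier G = carrier (H Mod h ` N)"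
    unfolding carrier_FactGroup surj[symmetric] by (simp add: image_image)
  ultimately show "G Mod N \<cong> H Mod h ` N"
    using f.FactGroup_iso by simp
qed

lemma iso_imp_group_hom: "h \<in> iso G H \<Longrightarrow> group G \<Longrightarrow> group H \<Longrightarrow> group_hom G H h"
  by (simp add: group_hom_def group_hom_axioms_def iso_def)

lemma FactGroup_iso_image:
  assumes "h \<in> iso G H" "group G" "group H" "N \<lhd> G"
  shows "h ` N \<lhd> H" and "G Mod N \<cong> H Mod h ` N"
proof -
  interpret group_hom G H h
    using assms(1-3) by (rule iso_imp_group_hom)
  have "kernel G H h = {\<one>\<^bsub>G\<^esub>}"
    using assms(1) by (simp add: iso_kernel_image)
  moreover have "\<one>\<^bsub>G\<^esub> \<in> N"
    using assms(4) normal_imp_subgroup subgroup.one_closed by blast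
  moreover have "h ` carrier G = carrier H"
    using assms(1) by (simp add: iso_kernel_image)
  ultimately show "h ` N \<lhd> H" and "G Mod N \<cong> H Mod h ` N"
    using FactGroup_image_iso[of N] assms(4) by auto
qed

lemma (in normal) rcos_group_hom: "group_hom G (G Mod H) (\<lambda>x. H #> x)"
  by (simp add: group_hom_def group_hom_axioms_def factorgroup_is_group r_coset_hom_Mod)

lemma (in normal) kernel_rcos: "kernel G (G Mod H) (\<lambda>x. H #> x) = H"
  using coset_join1[OF _ _ subgroup_axioms] coset_join2[OF _ subgroup_axioms]
  by (auto simp: kernel_def)

section \<open>Indices\<close>

lemma (in group) lagrange_subgroup:
  assumes "subgroup L G" and "subgroup K G" and "K \<subseteq> L"
  shows "card (rcosets\<^bsub>G\<lparr>carrier := L\<rparr>\<^esub> K) * card K = card L"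
  using group.lagrange[OF subgroup_imp_group subgroup_incl] assms by (simp add: order_def)

lemma (in group) card_subgroup_dvd:
  "subgroup L G \<Longrightarrow> subgroup K G \<Longrightarrow> K \<subseteq> L \<Longrightarrow> card K dvd card L"
  by (metis lagrange_subgroup dvd_triv_right)

lemma (in group_hom) order_eq_card_kernel_mult:
  assumes "h ` carrier G = carrier H"
  shows "order G = order H * card (kernel G H h)"
  using G.lagrange[OF subgroup_kernel] iso_same_card[OF FactGroup_iso[OF assms]]
  by (simp add: order_def FactGroup_def)

lemma (in group_hom) card_rcosets_vimage:
  assumes fin: "finite (carrier G)" and surj: "h ` carrier G = carrier H" and M: "subgroup M H"
  shows "card (rcosets\<^bsub>G\<^esub> {x \<in> carrier G. h x \<in> M}) = card (rcosets\<^bsub>H\<^esub> M)"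
proof -
  let ?V = "{x \<in> carrier G. h x \<in> M}"
  have V: "subgroup ?V G"
    using M by (rule vimage_subgroup)
  have image_V: "h ` ?V = M"
    using surj subgroup.subset[OF M] by (rule image_vimage_eq)
  interpret r: group_hom "G\<lparr>carrier := ?V\<rparr>" "H\<lparr>carrier := M\<rparr>" h
    using induced_group_hom[OF V] by (simp only: image_V)
  have "kernel (G\<lparr>carrier := ?V\<rparr>) (H\<lparr>carrier := M\<rparr>) h = kernel G H h"
    using subgroup.one_closed[OF M] by (auto simp: kernel_def)
  then have "card ?V = card M * card (kernel G H h)"
    using r.order_eq_card_kernel_mult image_V by (simp add: order_def)
  then have "card (rcosets\<^bsub>G\<^esub> ?V) * card ?V = card (rcosets\<^bsub>H\<^esub> M) * card ?V"
    using G.lagrange[OF V] H.lagrange[OF M] order_eq_card_kernel_mult[OF surj]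
    by (metis mult.assoc)
  then show ?thesis
    using subgroup.finite_imp_card_positive[OF V fin] by simp
qed

lemma (in group) second_isomorphism_grpI:
  "N \<lhd> G \<Longrightarrow> subgroup M G \<Longrightarrow> second_isomorphism_grp N G M"
  by (simp add: second_isomorphism_grp_def second_isomorphism_grp_axioms_def)

lemma (in group) card_normal_eq_index_mult:
  assumes fin: "finite (carrier G)" and N: "N \<lhd> G" and M: "subgroup M G"
    and NM: "N <#> M = carrier G"
  shows "card N = card (rcosets M) * card (N \<inter> M)"
proof -
  interpret second_isomorphism_grp N G M
    using N M by (rule second_isomorphism_grpI)
  let ?M = "G\<lparr>carrier := M\<rparr>"
  have "card (rcosets\<^bsub>?M\<^esub> (N \<inter> M)) = card (rcosets N)"
    using iso_same_card[OF is_isoI[OF normal_intersection_quotient_isom]] NM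
    by (simp add: FactGroup_def)
  moreover have "card (rcosets\<^bsub>?M\<^esub> (N \<inter> M)) * card (N \<inter> M) = card M"
    using M subgroup_axioms by (intro lagrange_subgroup) (auto intro: subgroups_Inter_pair)
  ultimately have "card M * (card (rcosets M) * card (N \<inter> M)) = card M * card N"
    using lagrange[OF subgroup_axioms] lagrange[OF M] by (metis mult.assoc mult.commute)
  then show ?thesis
    using subgroup.finite_imp_card_positive[OF M fin] by simp
qed

section \<open>Actions on cosets and Sylow subgroups\<close>

lemma (in group_action) p_group_fixed_point:
  assumes p: "Factorial_Ring.prime p" and ord: "order G = p ^ a"
    and E: "finite E" "\<not> p dvd card E"
  shows "\<exists>x\<in>E. \<forall>g\<in>carrier G. \<phi> g x = x"
proof -
  have "card E = (\<Sum>orb\<in>orbits G E \<phi>. card orb)"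
    using disjoint_sum[OF E(1), of "\<lambda>_. 1::nat"] by simp
  then obtain orb where "orb \<in> orbits G E \<phi>" and ndvd: "\<not> p dvd card orb"
    using E(2) by (metis dvd_sum)
  then obtain x where x: "x \<in> E" "orb = orbit G \<phi> x"
    by (auto simp: orbits_def)
  have "card orb dvd p ^ a"
    using orbit_stabilizer_theorem[OF x(1)] x(2) ord by (metis dvd_triv_left)
  then obtain i where "card orb = p ^ i"
    using divides_primepow_nat[OF p] by blast
  then have "card orb = 1"
    using ndvd by (cases i) auto
  then have "orbit G \<phi> x = {x}"
    using x orbit_refl[of x] by (auto simp: card_1_singleton_iff)
  then have "\<phi> g x = x" if "g \<in> carrier G" for g
    using that by (auto simp: orbit_def)
  then show ?thesis
    using x(1) by blast
qed

lemma (in group) group_action_rcosets: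
  assumes K: "subgroup K G"
  shows "group_action G (rcosets K) (\<lambda>g. \<lambda>C\<in>rcosets K. C #> inv g)"
proof -
  let ?\<phi> = "\<lambda>g. \<lambda>C\<in>rcosets K. C #> inv g"
  have sub: "C \<subseteq> carrier G" if "C \<in> rcosets K" for C
    using that subgroup.rcosets_carrier[OF K group_axioms] by blast
  have closed: "C #> g \<in> rcosets K" if "C \<in> rcosets K" "g \<in> carrier G" for C g
    using that subgroup.subset[OF K] by (auto simp: RCOSETS_def coset_mult_assoc)
  have bij: "?\<phi> g \<in> Bij (rcosets K)" if "g \<in> carrier G" for g
  proof -
    have "bij_betw (\<lambda>C. C #> inv g) (rcosets K) (rcosets K)"
      by (rule bij_betw_byWitness[where f' = "\<lambda>C. C #> g"])
        (use that sub closed in \<open>auto simp: coset_mult_assoc\<close>)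
    then show ?thesis
      by (simp add: Bij_def cong: bij_betw_cong)
  qed
  have "?\<phi> \<in> hom G (BijGroup (rcosets K))"
  proof (rule homI)
    fix x y assume xy: "x \<in> carrier G" "y \<in> carrier G"
    have "?\<phi> (x \<otimes> y) = compose (rcosets K) (?\<phi> x) (?\<phi> y)"
      by (rule ext) (use xy sub closed in
          \<open>auto simp: compose_def restrict_def coset_mult_assoc inv_mult_group\<close>)
    then show "?\<phi> (x \<otimes> y) = ?\<phi> x \<otimes>\<^bsub>BijGroup (rcosets K)\<^esub> ?\<phi> y"
      using bij xy by (simp add: BijGroup_def)
  qed (use bij in \<open>simp add: BijGroup_def\<close>)
  then show ?thesis
    by (simp add: group_action_def group_hom_def group_hom_axioms_def group_BijGroup)
qed

lemma (in group) finite_rcosets: "finite (carrier G) \<Longrightarrow> finite (rcosets K)"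
  by (simp add: RCOSETS_def)

lemma (in group) p_subgroup_conj_subset:
  assumes fin: "finite (carrier G)" and p: "Factorial_Ring.prime p"
    and P: "subgroup P G" "card P = p ^ a"
    and K: "subgroup K G" "\<not> p dvd card (rcosets K)"
  shows "\<exists>g\<in>carrier G. \<forall>x\<in>P. g \<otimes> x \<otimes> inv g \<in> K"
proof -
  interpret group_action "G\<lparr>carrier := P\<rparr>" "rcosets K" "\<lambda>g. \<lambda>C\<in>rcosets K. C #> inv g"
    by (rule group_action.induced_action[OF group_action_rcosets[OF K(1)] P(1)])
  obtain C where "C \<in> rcosets K" and fixed: "\<And>x. x \<in> P \<Longrightarrow> C #> inv x = C"
    using p_group_fixed_point[OF p, of a] P(2) K(2) fin
    by (fastforce simp: order_def finite_rcosets)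
  then obtain g where g: "g \<in> carrier G" "C = K #> g"
    by (auto simp: RCOSETS_def)
  have "g \<otimes> x \<otimes> inv g \<in> K" if "x \<in> P" for x
  proof -
    have x: "x \<in> carrier G"
      using subgroup.mem_carrier[OF P(1) that] .
    have "K #> (g \<otimes> inv x) = K #> g"
      using fixed[OF that] g x subgroup.subset[OF K(1)] by (simp add: coset_mult_assoc)
    then have "g \<in> K #> (g \<otimes> inv x)"
      using rcos_self[OF g(1) K(1)] by simp
    then have "g \<otimes> inv (g \<otimes> inv x) \<in> K"
      using g x by (simp add: subgroup.rcos_module[OF K(1) group_axioms])
    then show ?thesis
      using g x by (simp add: inv_mult_group m_assoc)
  qed
  then show ?thesis
    using g(1) by blast
qed

lemma (in group) ex_subgroup_prime_power_card:
  assumes "finite (carrier G)" "Factorial_Ring.prime p" and N: "subgroup N G" and "p ^ a dvd card N"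
  shows "\<exists>Q. subgroup Q G \<and> Q \<subseteq> N \<and> card Q = p ^ a"
proof -
  have "finite N"
    using subgroup.subset[OF N] assms(1) by (rule finite_subset)
  then obtain Q where "subgroup Q (G\<lparr>carrier := N\<rparr>)" "card Q = p ^ a"
    using sylow_thm[OF assms(2) subgroup_imp_group[OF N]] assms(4) by (auto simp: order_def dvd_def)
  then show ?thesis
    using incl_subgroup[OF N] subgroup.subset by fastforce
qed

lemma (in group) conjugation_group_hom:
  assumes "g \<in> carrier G"
  shows "group_hom G G (\<lambda>x. g \<otimes> x \<otimes> inv g)"
proof -
  have "(\<lambda>x. g \<otimes> x \<otimes> inv g) \<in> hom G G"
    by (rule homI) (use assms in \<open>auto simp: m_assoc simp flip: m_assoc[of "inv g" g]\<close>)
  then show ?thesis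
    by (simp add: group_hom_def group_hom_axioms_def)
qed

lemma (in group) conjugation_inj_on:
  "g \<in> carrier G \<Longrightarrow> A \<subseteq> carrier G \<Longrightarrow> inj_on (\<lambda>x. g \<otimes> x \<otimes> inv g) A"
  by (rule inj_onI) (metis conjugation_is_inj subsetD)

lemma (in group) mem_normalizer_if_finite:
  assumes "finite A" "A \<subseteq> carrier G" "g \<in> carrier G" "\<And>x. x \<in> A \<Longrightarrow> g \<otimes> x \<otimes> inv g \<in> A"
  shows "g \<in> normalizer G A"
proof -
  have "g <# A #> inv g = (\<lambda>x. g \<otimes> x \<otimes> inv g) ` A"
    by (auto simp: l_coset_def r_coset_def)
  also have "\<dots> = A"
    using assms conjugation_inj_on by (intro endo_inj_surj) auto
  finally show ?thesis
    using assms by (simp add: normalizer_def stabilizer_def)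
qed

lemma (in group) frattini_argument:
  assumes fin: "finite (carrier G)" and p: "Factorial_Ring.prime p" and N: "N \<lhd> G"
    and Q: "subgroup Q G" "Q \<subseteq> N" "card Q = p ^ a"
    and index: "\<not> p dvd card (rcosets\<^bsub>G\<lparr>carrier := N\<rparr>\<^esub> Q)"
  shows "N <#> normalizer G Q = carrier G"
proof
  interpret N: normal N G by (rule N)
  interpret NG: group "G\<lparr>carrier := N\<rparr>"
    using N.subgroup_axioms by (rule subgroup_imp_group)
  have Q_carrier: "Q \<subseteq> carrier G"
    using Q(1) by (rule subgroup.subset)
  show "N <#> normalizer G Q \<subseteq> carrier G"
    using N.subset normalizer_imp_subgroup[OF Q_carrier] subgroup.subset setmult_subset_G by blast
  show "carrier G \<subseteq> N <#> normalizer G Q"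
  proof
    fix g assume g: "g \<in> carrier G"
    let ?P = "(\<lambda>x. g \<otimes> x \<otimes> inv g) ` Q"
    have "subgroup ?P G"
      using group_hom.subgroup_img_is_subgroup[OF conjugation_group_hom[OF g] Q(1)] .
    moreover have "?P \<subseteq> N"
      using Q(2) N.inv_op_closed2[OF g] by blast
    ultimately have "subgroup ?P (G\<lparr>carrier := N\<rparr>)"
      using N.subgroup_axioms by (intro subgroup_incl)
    moreover have "card ?P = p ^ a"
      using card_image[OF conjugation_inj_on[OF g Q_carrier]] Q(3) by simp
    moreover have "subgroup Q (G\<lparr>carrier := N\<rparr>)"
      using Q N.subgroup_axioms by (intro subgroup_incl)
    moreover have "finite N"
      using fin N.subset by (rule rev_finite_subset)
    ultimately obtain k where k: "k \<in> N" "\<forall>x\<in>?P. k \<otimes> x \<otimes> inv k \<in> Q"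
      using NG.p_subgroup_conj_subset[OF _ p _ _ _ index, of ?P a]
      by (auto simp: m_inv_consistent[OF N.subgroup_axioms])
    then have "(k \<otimes> g) \<otimes> x \<otimes> inv (k \<otimes> g) \<in> Q" if "x \<in> Q" for x
      using that g Q_carrier by (auto simp: m_assoc inv_mult_group subset_iff)
    then have "k \<otimes> g \<in> normalizer G Q"
      using g k(1) Q_carrier finite_subset[OF Q_carrier fin] by (intro mem_normalizer_if_finite) auto
    then have "inv k \<otimes> (k \<otimes> g) \<in> N <#> normalizer G Q"
      using k(1) by (auto simp: set_mult_def)
    then show "g \<in> N <#> normalizer G Q"
      using g k(1) by (simp flip: m_assoc)
  qed
qed

lemma card_Bij:
  assumes "finite S"
  shows "card (Bij S) = fact (card S)"
proof -
  let ?ext = "\<lambda>f x. if x \<in> S then f x else x"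
  have "bij_betw (\<lambda>p. restrict p S) {p. p permutes S} (Bij S)"
  proof (rule bij_betw_byWitness[where f' = ?ext])
    show "(\<lambda>p. restrict p S) ` {p. p permutes S} \<subseteq> Bij S"
      by (auto simp: Bij_def permutes_imp_bij cong: bij_betw_cong)
    show "?ext ` Bij S \<subseteq> {p. p permutes S}"
      by (auto simp: Bij_def intro!: bij_imp_permutes cong: bij_betw_cong)
  qed (auto simp: fun_eq_iff Bij_def extensional_def permutes_not_in)
  then show ?thesis
    using card_permutations[OF refl assms] bij_betw_same_card by metis
qed

section \<open>Maximal and minimal normal subgroups\<close>

lemma maximal_subgroup_imp_subgroup: "maximal_subgroup M G \<Longrightarrow> subgroup M G"
  by (simp add: maximal_subgroup_def)

lemma maximal_subgroupD:
  "maximal_subgroup M G \<Longrightarrow> subgroup K G \<Longrightarrow> M \<subseteq> K \<Longrightarrow> K = M \<or> K = carrier G"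
  by (simp add: maximal_subgroup_def)

lemma (in group) ex_maximal_subgroup_superset:
  assumes fin: "finite (carrier G)" and K: "subgroup K G" "K \<noteq> carrier G"
  shows "\<exists>M. maximal_subgroup M G \<and> K \<subseteq> M"
proof -
  let ?S = "{L. subgroup L G \<and> K \<subseteq> L \<and> L \<noteq> carrier G}"
  have "finite ?S"
    by (rule finite_subset[of _ "Pow (carrier G)"])
      (use fin in \<open>auto dest: subgroup.subset\<close>)
  moreover have "K \<in> ?S"
    using K by simp
  ultimately obtain M where "M \<in> ?S" and "\<forall>L\<in>?S. M \<subseteq> L \<longrightarrow> M = L"
    using finite_has_maximal[of ?S] by auto
  then have "maximal_subgroup M G" "K \<subseteq> M"
    by (auto simp: maximal_subgroup_def)
  then show ?thesis
    by blast
qed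

lemma (in group) normal_mult_maximal_eq_carrier:
  assumes N: "N \<lhd> G" and M: "maximal_subgroup M G" and "\<not> N \<subseteq> M"
  shows "N <#> M = carrier G"
proof -
  interpret second_isomorphism_grp N G M
    using N maximal_subgroup_imp_subgroup[OF M] by (rule second_isomorphism_grpI)
  show ?thesis
    using maximal_subgroupD[OF M normal_set_mult_subgroup S_contained_in_set_mult]
      H_contained_in_set_mult assms(3) by blast
qed

lemma (in group_hom) maximal_subgroup_vimage_iff:
  assumes surj: "h ` carrier G = carrier H" and M: "subgroup M H"
  shows "maximal_subgroup {x \<in> carrier G. h x \<in> M} G \<longleftrightarrow> maximal_subgroup M H"
    (is "maximal_subgroup (?v M) G \<longleftrightarrow> _")
proof
  have image: "h ` ?v K = K" if "subgroup K H" for K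
    using surj subgroup.subset[OF that] by (rule image_vimage_eq)
  have vimage_inj: "K = L" if "?v K = ?v L" "subgroup K H" "subgroup L H" for K L
    using image[OF that(2)] image[OF that(3)] unfolding that(1) by (rule trans[OF sym])
  show "maximal_subgroup M H" if max: "maximal_subgroup (?v M) G"
    unfolding maximal_subgroup_def
  proof (intro conjI allI impI)
    show "M \<noteq> carrier H"
      using max by (auto simp: maximal_subgroup_def)
    fix K assume K: "subgroup K H \<and> M \<subseteq> K"
    have vimage_carrier: "?v (carrier H) = carrier G"
      by auto
    have "?v K = ?v M \<or> ?v K = ?v (carrier H)"
      unfolding vimage_carrier
      using K by (intro maximal_subgroupD[OF max] vimage_subgroup) auto
    then show "K = M \<or> K = carrier H"
      using K M H.subgroup_self vimage_inj[of K M] vimage_inj[of K "carrier H"] by satx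
  qed (rule M)
  show "maximal_subgroup (?v M) G" if max: "maximal_subgroup M H"
    unfolding maximal_subgroup_def
  proof (intro conjI allI impI)
    have "M \<noteq> carrier H"
      using max by (simp add: maximal_subgroup_def)
    then show "?v M \<noteq> carrier G"
      using image[OF M] surj by auto
    fix K assume K: "subgroup K G \<and> ?v M \<subseteq> K"
    then have "h ` K = M \<or> h ` K = carrier H"
      using image[OF M] by (intro maximal_subgroupD[OF max] subgroup_img_is_subgroup) auto
    moreover have "?v (h ` K) = K"
      using K subgroup.one_closed[OF M] by (intro vimage_image_eq) (auto simp: kernel_def)
    ultimately show "K = ?v M \<or> K = carrier G"
      by auto
  qed (rule vimage_subgroup[OF M])
qed

lemma minimal_normal_imp_normal: "minimal_normal N G \<Longrightarrow> N \<lhd> G"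
  by (simp add: minimal_normal_def)

lemma minimal_normalD:
  "minimal_normal N G \<Longrightarrow> K \<lhd> G \<Longrightarrow> K \<subseteq> N \<Longrightarrow> K = {\<one>\<^bsub>G\<^esub>} \<or> K = N"
  by (simp add: minimal_normal_def)

lemma minimal_normal_subset_carrier: "minimal_normal N G \<Longrightarrow> N \<subseteq> carrier G"
  by (simp add: minimal_normal_imp_normal normal_imp_subgroup subgroup.subset)

lemma (in group) ex_minimal_normal_subset:
  assumes fin: "finite (carrier G)" and K: "K \<lhd> G" "K \<noteq> {\<one>}"
  shows "\<exists>N. minimal_normal N G \<and> N \<subseteq> K"
proof -
  let ?S = "{L. L \<lhd> G \<and> L \<subseteq> K \<and> L \<noteq> {\<one>}}"
  have "finite ?S"
    by (rule finite_subset[of _ "Pow (carrier G)"])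
      (use fin in \<open>auto dest!: normal_imp_subgroup subgroup.subset\<close>)
  moreover have "K \<in> ?S"
    using K by simp
  ultimately obtain N where "N \<in> ?S" and "\<forall>L\<in>?S. L \<subseteq> N \<longrightarrow> N = L"
    using finite_has_minimal[of ?S] by auto
  then have "minimal_normal N G" "N \<subseteq> K"
    by (auto simp: minimal_normal_def)
  then show ?thesis
    by blast
qed

lemma minimal_normal_iso_image:
  assumes f: "f \<in> iso G K" and G: "group G" and K: "group K" and N: "minimal_normal N G"
  shows "minimal_normal (f ` N) K"
  unfolding minimal_normal_def
proof (intro conjI allI impI)
  interpret f: group_hom G K f
    using f G K by (rule iso_imp_group_hom)
  define g where "g = inv_into (carrier G) f"
  have g: "g \<in> iso K G"
    unfolding g_def using f by (rule f.G.iso_set_sym)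
  have f_g: "f ` g ` L = L" if "L \<subseteq> carrier K" for L
    unfolding g_def using that f by (simp add: iso_def bij_betw_def image_inv_into_cancel)
  have g_f: "g ` f ` L = L" if "L \<subseteq> carrier G" for L
    unfolding g_def using that f by (simp add: iso_def bij_betw_def)
  have N_carrier: "N \<subseteq> carrier G"
    using N by (rule minimal_normal_subset_carrier)
  show "f ` N \<lhd> K"
    using f G K minimal_normal_imp_normal[OF N] by (rule iso_normal_subgroup)
  show "f ` N \<noteq> {\<one>\<^bsub>K\<^esub>}"
    using g_f[OF N_carrier] N group_hom.hom_one[OF iso_imp_group_hom[OF g K G]]
    by (auto simp: minimal_normal_def)
  fix L assume L: "L \<lhd> K \<and> L \<subseteq> f ` N"
  then have "g ` L \<lhd> G"
    using g K G by (blast intro: iso_normal_subgroup)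
  moreover have "g ` L \<subseteq> N"
    using L g_f[OF N_carrier] by blast
  moreover have "f ` g ` L = L"
    using L by (intro f_g) (auto dest: normal_imp_subgroup subgroup.subset)
  ultimately show "L = {\<one>\<^bsub>K\<^esub>} \<or> L = f ` N"
    using minimal_normalD[OF N, of "g ` L"] f.hom_one by auto
qed

section \<open>Frattini subgroup and socle\<close>

lemma (in group) frattini_subgroup: "subgroup (frattini G) G"
proof -
  have "frattini G = \<Inter> (insert (carrier G) {M. maximal_subgroup M G})"
    by (simp add: frattini_def)
  moreover have "subgroup (\<Inter> (insert (carrier G) {M. maximal_subgroup M G})) G"
    by (rule subgroups_Inter) (auto simp: maximal_subgroup_def subgroup_self)
  ultimately show ?thesis
    by simp
qed

lemma frattini_subset_maximal: "maximal_subgroup M G \<Longrightarrow> frattini G \<subseteq> M"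
  by (auto simp: frattini_def)

lemma (in group) frattini_mult_eq_carrierD:
  assumes fin: "finite (carrier G)" and K: "subgroup K G"
    and eq: "frattini G <#> K = carrier G"
  shows "K = carrier G"
proof (rule ccontr)
  assume "K \<noteq> carrier G"
  then obtain M where M: "maximal_subgroup M G" "K \<subseteq> M"
    using ex_maximal_subgroup_superset[OF fin K] by blast
  then have "frattini G <#> K \<subseteq> M <#> M"
    by (intro mono_set_mult frattini_subset_maximal)
  also have "\<dots> = M"
    using M(1) by (intro subgroup_mult_id maximal_subgroup_imp_subgroup)
  finally show False
    using eq M(1) subgroup.subset[of M G] by (auto simp: maximal_subgroup_def)
qed

lemma (in group_hom) frattini_image:
  assumes surj: "h ` carrier G = carrier H" and ker: "kernel G H h \<subseteq> frattini G"
  shows "frattini H = h ` frattini G"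
proof
  show "h ` frattini G \<subseteq> frattini H"
    using maximal_subgroup_vimage_iff[OF surj] maximal_subgroup_imp_subgroup[of _ H]
    by (auto simp: frattini_def)
  show "frattini H \<subseteq> h ` frattini G"
  proof
    fix y assume y: "y \<in> frattini H"
    then obtain x where x: "x \<in> carrier G" "y = h x"
      using surj by (auto simp: frattini_def)
    have "x \<in> M" if M: "maximal_subgroup M G" for M
    proof -
      have sub: "subgroup M G"
        using M by (rule maximal_subgroup_imp_subgroup)
      have vimage: "{x \<in> carrier G. h x \<in> h ` M} = M"
        using sub ker frattini_subset_maximal[OF M] by (intro vimage_image_eq) auto
      then have "maximal_subgroup (h ` M) H"
        using M maximal_subgroup_vimage_iff[OF surj subgroup_img_is_subgroup[OF sub]] by simp
      then have "h x \<in> h ` M"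
        using y x(2) frattini_subset_maximal by blast
      then show ?thesis
        using vimage x(1) by blast
    qed
    then have "x \<in> frattini G"
      using x(1) by (simp add: frattini_def)
    then show "y \<in> h ` frattini G"
      using x(2) by simp
  qed
qed

lemma frattini_iso_image:
  assumes "f \<in> iso G K" "group G" "group K"
  shows "f ` frattini G = frattini K"
proof -
  interpret group_hom G K f
    using assms by (rule iso_imp_group_hom)
  have "kernel G K f = {\<one>\<^bsub>G\<^esub>}" "f ` carrier G = carrier K"
    using assms(1) by (simp_all add: iso_kernel_image)
  then show ?thesis
    using frattini_image subgroup.one_closed[OF G.frattini_subgroup] by simp
qed

lemma (in group) socle_subgroup: "subgroup (socle G) G"
  unfolding socle_def using minimal_normal_subset_carrier by (intro generate_is_subgroup) blast

lemma minimal_normal_subset_socle: "minimal_normal N G \<Longrightarrow> N \<subseteq> socle G"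
  by (auto simp: socle_def intro: generate.incl)

lemma socle_iso_image:
  assumes "f \<in> iso G K" "group G" "group K"
  shows "f ` socle G \<subseteq> socle K"
proof -
  interpret group_hom G K f
    using assms by (rule iso_imp_group_hom)
  have "f ` socle G = generate K (f ` \<Union> {N. minimal_normal N G})"
    unfolding socle_def using minimal_normal_subset_carrier by (intro generate_img[symmetric]) blast
  also have "\<dots> \<subseteq> socle K"
    unfolding socle_def using minimal_normal_iso_image[OF assms] by (intro H.mono_generate) blast
  finally show ?thesis .
qed

lemma (in normal) normal_if_characteristic:
  assumes S: "subgroup S (G\<lparr>carrier := H\<rparr>)"
    and char: "\<And>f. f \<in> iso (G\<lparr>carrier := H\<rparr>) (G\<lparr>carrier := H\<rparr>) \<Longrightarrow> f ` S \<subseteq> S"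
  shows "S \<lhd> G"
proof (rule normal_invI)
  show "subgroup S G"
    using subgroup_axioms S by (rule incl_subgroup)
  fix g s assume g: "g \<in> carrier G" and s: "s \<in> S"
  let ?c = "\<lambda>x. g \<otimes> x \<otimes> inv g"
  interpret c: group_hom G G ?c
    using g by (rule conjugation_group_hom)
  have "x \<in> ?c ` H" if x: "x \<in> H" for x
    using conjugation_is_surj[OF g mem_carrier[OF x]] inv_op_closed1[OF g x] by (metis imageI)
  then have "?c ` H = H"
    using inv_op_closed2[OF g] by blast
  then have "?c \<in> iso (G\<lparr>carrier := H\<rparr>) (G\<lparr>carrier := H\<rparr>)"
    using c.induced_group_hom[OF subgroup_axioms] conjugation_inj_on[OF g subset]
    by (simp add: iso_def bij_betw_def group_hom_def group_hom_axioms_def)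
  then show "?c s \<in> S"
    using char s by blast
qed

lemma (in normal) normal_frattini: "frattini (G\<lparr>carrier := H\<rparr>) \<lhd> G"
proof -
  interpret H: group "G\<lparr>carrier := H\<rparr>"
    using subgroup_axioms by (rule subgroup_imp_group)
  show ?thesis
    by (rule normal_if_characteristic[OF H.frattini_subgroup])
      (simp add: frattini_iso_image H.group_axioms)
qed

lemma (in group) frattini_normal: "frattini G \<lhd> G"
  using normal.normal_frattini[OF normal_self] by simp

lemma (in normal) normal_socle: "socle (G\<lparr>carrier := H\<rparr>) \<lhd> G"
proof -
  interpret H: group "G\<lparr>carrier := H\<rparr>"
    using subgroup_axioms by (rule subgroup_imp_group)
  show ?thesis
    by (rule normal_if_characteristic[OF H.socle_subgroup])
      (simp only: socle_iso_image H.group_axioms)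
qed

lemma (in normal) frattini_mono:
  assumes fin: "finite (carrier G)"
  shows "frattini (G\<lparr>carrier := H\<rparr>) \<subseteq> frattini G"
proof -
  let ?P = "frattini (G\<lparr>carrier := H\<rparr>)"
  interpret H: group "G\<lparr>carrier := H\<rparr>"
    using subgroup_axioms by (rule subgroup_imp_group)
  have P_le_H: "?P \<subseteq> H"
    by (auto simp: frattini_def)
  have "?P \<subseteq> M" if M: "maximal_subgroup M G" for M
  proof (rule ccontr)
    assume not_subset: "\<not> ?P \<subseteq> M"
    have M_sub: "subgroup M G"
      using M by (rule maximal_subgroup_imp_subgroup)
    have "?P <#> (H \<inter> M) = H \<inter> (?P <#> M)"
      using subgroup_axioms P_le_H subgroup.subset[OF M_sub] by (rule modular_law[symmetric])
    also have "\<dots> = H"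
      using normal_mult_maximal_eq_carrier[OF normal_frattini M not_subset] subset by auto
    finally have "H \<inter> M = H"
      using H.frattini_mult_eq_carrierD[of "H \<inter> M"] finite_subset[OF subset fin] M_sub
        subgroup_axioms by (simp add: subgroup_incl subgroups_Inter_pair)
    then show False
      using P_le_H not_subset by blast
  qed
  then show ?thesis
    using P_le_H subset by (auto simp: frattini_def)
qed

lemma (in normal) minimal_normal_subset_socle_normal:
  assumes fin: "finite (carrier G)" and N: "minimal_normal N G" "N \<subseteq> H"
  shows "N \<subseteq> socle (G\<lparr>carrier := H\<rparr>)"
proof -
  let ?H = "G\<lparr>carrier := H\<rparr>"
  interpret H: group ?H
    using subgroup_axioms by (rule subgroup_imp_group)
  have "N \<lhd> ?H"
    using subgroup_axioms minimal_normal_imp_normal[OF N(1)] N(2)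
    by (rule normal_restrict_supergroup)
  moreover have "N \<noteq> {\<one>\<^bsub>?H\<^esub>}"
    using N(1) by (simp add: minimal_normal_def)
  ultimately obtain R where R: "minimal_normal R ?H" "R \<subseteq> N"
    using H.ex_minimal_normal_subset[of N] finite_subset[OF subset fin] by auto
  then have "R \<subseteq> N \<inter> socle ?H"
    using minimal_normal_subset_socle by blast
  moreover have "R \<noteq> {\<one>}" "\<one> \<in> R"
    using R(1) subgroup.one_closed[OF normal_imp_subgroup[of R ?H]]
    by (simp_all add: minimal_normal_def)
  moreover have "N \<inter> socle ?H \<lhd> G"
    using minimal_normal_imp_normal[OF N(1)] normal_socle by (rule normal_subgroup_intersect)
  ultimately show ?thesis
    using minimal_normalD[OF N(1), of "N \<inter> socle ?H"] by blast
qed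

section \<open>Maximal subgroups of prime index\<close>

lemma (in group) minimal_normal_card_dvd_fact_index:
  assumes fin: "finite (carrier G)" and N: "minimal_normal N G"
    and K: "subgroup K G" "\<not> N \<subseteq> K"
  shows "card N dvd fact (card (rcosets K))"
proof -
  let ?\<phi> = "\<lambda>g. \<lambda>C\<in>rcosets K. C #> inv g" and ?S = "BijGroup (rcosets K)"
  interpret \<phi>: group_hom G ?S ?\<phi>
    by (rule group_action.group_hom[OF group_action_rcosets[OF K(1)]])
  have "kernel G ?S ?\<phi> \<subseteq> K"
  proof
    fix g assume "g \<in> kernel G ?S ?\<phi>"
    then have g: "g \<in> carrier G" "?\<phi> g = (\<lambda>C\<in>rcosets K. C)"
      by (simp_all add: kernel_def BijGroup_def)
    have "K \<in> rcosets K"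
      using K(1) group_axioms by (rule subgroup.subgroup_in_rcosets)
    then have "K #> inv g = K"
      using fun_cong[OF g(2), of K] by simp
    then have "inv g \<in> K"
      using coset_join1[OF _ inv_closed[OF g(1)] K(1)] by simp
    then show "g \<in> K"
      using g(1) subgroup.m_inv_closed[OF K(1)] by fastforce
  qed
  moreover have "N \<inter> kernel G ?S ?\<phi> \<lhd> G"
    using minimal_normal_imp_normal[OF N] \<phi>.normal_kernel by (rule normal_subgroup_intersect)
  ultimately have "N \<inter> kernel G ?S ?\<phi> = {\<one>}"
    using minimal_normalD[OF N] K(2) by blast
  then have "kernel (G\<lparr>carrier := N\<rparr>) ?S ?\<phi> = {\<one>}"
    using minimal_normal_subset_carrier[OF N] by (auto simp: kernel_def)
  moreover have N_sub: "subgroup N G"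
    using N by (intro normal_imp_subgroup minimal_normal_imp_normal)
  ultimately have "card N = card (?\<phi> ` N)"
    using \<phi>.inj_on_subgroup_iff_trivial_ker by (metis card_image)
  also have "\<dots> dvd order ?S"
    using \<phi>.H.lagrange[OF \<phi>.subgroup_img_is_subgroup[OF N_sub]] by (metis dvd_triv_right)
  also have "\<dots> = fact (card (rcosets K))"
    using fin by (simp add: order_def BijGroup_def card_Bij finite_rcosets)
  finally show ?thesis .
qed

lemma prime_power2_not_dvd_fact:
  fixes p :: nat
  assumes p: "Factorial_Ring.prime p"
  shows "\<not> p ^ 2 dvd fact p"
proof
  assume "p ^ 2 dvd fact p"
  then have "p dvd fact (p - 1)"
    using prime_gt_0_nat[OF p] by (simp add: fact_reduce power2_eq_square)
  then show False
    using prime_gt_0_nat[OF p] by (simp add: prime_dvd_fact_iff[OF p])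
qed

lemma (in group) minimal_normal_prime_index:
  assumes fin: "finite (carrier G)" and N: "minimal_normal N G"
    and M: "maximal_subgroup M G" "\<not> N \<subseteq> M" and p: "Factorial_Ring.prime (card (rcosets M))"
  shows "card N = card (rcosets M) * card (N \<inter> M)"
    and "Factorial_Ring.prime q \<Longrightarrow> q dvd card N \<Longrightarrow> q \<le> card (rcosets M)"
    and "\<not> card (rcosets M) ^ 2 dvd card N"
proof -
  have M_sub: "subgroup M G"
    using M(1) by (rule maximal_subgroup_imp_subgroup)
  have N_normal: "N \<lhd> G"
    using N by (rule minimal_normal_imp_normal)
  show "card N = card (rcosets M) * card (N \<inter> M)"
    using fin N_normal M_sub normal_mult_maximal_eq_carrier[OF N_normal M]
    by (rule card_normal_eq_index_mult)
  have dvd: "card N dvd fact (card (rcosets M))"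
    using fin N M_sub M(2) by (rule minimal_normal_card_dvd_fact_index)
  show "q \<le> card (rcosets M)" if "Factorial_Ring.prime q" "q dvd card N"
    using that dvd by (metis dvd_trans prime_dvd_fact_iff)
  show "\<not> card (rcosets M) ^ 2 dvd card N"
    using dvd prime_power2_not_dvd_fact[OF p] dvd_trans by blast
qed

lemma (in group) sylow_normal_if_maximal_supersets:
  assumes fin: "finite (carrier G)" and p: "Factorial_Ring.prime p" and N: "N \<lhd> G"
    and Q: "subgroup Q G" "Q \<subseteq> N" "card Q = p ^ a"
    and index: "\<not> p dvd card (rcosets\<^bsub>G\<lparr>carrier := N\<rparr>\<^esub> Q)"
    and maximal: "\<And>M. maximal_subgroup M G \<Longrightarrow> Q \<subseteq> M \<Longrightarrow> N \<subseteq> M"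
  shows "Q \<lhd> G"
proof -
  have normalizer: "subgroup (normalizer G Q) G" "Q \<subseteq> normalizer G Q"
    using normalizer_imp_subgroup subgroup.subset[OF Q(1)]
      subgroup.subset[OF normal_imp_subgroup[OF subgroup_in_normalizer[OF Q(1)]]] by auto
  have "normalizer G Q = carrier G"
  proof (rule ccontr)
    assume "normalizer G Q \<noteq> carrier G"
    then obtain M where M: "maximal_subgroup M G" "normalizer G Q \<subseteq> M"
      using ex_maximal_subgroup_superset[OF fin normalizer(1)] by blast
    have "N <#> normalizer G Q \<subseteq> M <#> M"
      using M maximal[OF M(1)] normalizer(2) by (intro mono_set_mult) auto
    also have "\<dots> = M"
      using M(1) by (intro subgroup_mult_id maximal_subgroup_imp_subgroup)
    finally have "carrier G \<subseteq> M"
      by (simp only: frattini_argument[OF fin p N Q index])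
    then show False
      using M(1) subgroup.subset[OF maximal_subgroup_imp_subgroup[OF M(1)]]
      by (auto simp: maximal_subgroup_def)
  qed
  then show ?thesis
    using subgroup_in_normalizer[OF Q(1)] by simp
qed

lemma (in group) minimal_normal_prime_order:
  assumes fin: "finite (carrier G)" and N: "minimal_normal N G"
    and index: "\<And>M. maximal_subgroup M G \<Longrightarrow> \<not> N \<subseteq> M \<Longrightarrow> Factorial_Ring.prime (card (rcosets M))"
    and M: "maximal_subgroup M G" "\<not> N \<subseteq> M"
  shows "Factorial_Ring.prime (card N)"
proof -
  have N_normal: "N \<lhd> G"
    using N by (rule minimal_normal_imp_normal)
  have N_sub: "subgroup N G"
    using N_normal by (rule normal_imp_subgroup)
  define p where "p = card (rcosets M)"
  have p: "Factorial_Ring.prime p"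
    unfolding p_def using M by (rule index)
  note p_index = minimal_normal_prime_index[OF fin N M p[unfolded p_def], folded p_def]
  obtain Q where Q: "subgroup Q G" "Q \<subseteq> N" and card_Q: "card Q = p"
    using ex_subgroup_prime_power_card[OF fin p N_sub, of 1] p_index(1) by auto
  have "\<not> p dvd card (rcosets\<^bsub>G\<lparr>carrier := N\<rparr>\<^esub> Q)"
    using lagrange_subgroup[OF N_sub Q] p_index(3) card_Q
    by (metis mult_dvd_mono dvd_refl power2_eq_square)
  moreover have "N \<subseteq> K" if K: "maximal_subgroup K G" "Q \<subseteq> K" for K
  proof (rule ccontr)
    assume "\<not> N \<subseteq> K"
    note K_index = minimal_normal_prime_index[OF fin N K(1) this index[OF K(1) this]]
    have "card (rcosets K) = p"
      using p_index(1,2) K_index(1,2) p index[OF K(1) \<open>\<not> N \<subseteq> K\<close>] by (metis antisym dvd_triv_left)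
    moreover have "p dvd card (N \<inter> K)"
      using subgroups_Inter_pair[OF N_sub maximal_subgroup_imp_subgroup[OF K(1)]] Q K(2)
      unfolding card_Q[symmetric] by (intro card_subgroup_dvd) auto
    ultimately show False
      using K_index(1) p_index(3) by (simp add: power2_eq_square)
  qed
  ultimately have "Q \<lhd> G"
    using card_Q by (intro sylow_normal_if_maximal_supersets[OF fin p N_normal Q, of 1]) auto
  moreover have "Q \<noteq> {\<one>}"
    using card_Q p by auto
  ultimately have "Q = N"
    using minimal_normalD[OF N] Q(2) by blast
  then show ?thesis
    using card_Q p by simp
qed

section \<open>Centralizers and cyclic groups\<close>

definition centralizer :: "('a, 'b) monoid_scheme \<Rightarrow> 'a set \<Rightarrow> 'a set"
  where "centralizer G S = {g \<in> carrier G. \<forall>s\<in>S. g \<otimes>\<^bsub>G\<^esub> s = s \<otimes>\<^bsub>G\<^esub> g}"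

lemma centralizerD: "g \<in> centralizer G S \<Longrightarrow> s \<in> S \<Longrightarrow> g \<otimes>\<^bsub>G\<^esub> s = s \<otimes>\<^bsub>G\<^esub> g"
  unfolding centralizer_def by blast

lemma (in group) centralizer_subgroup:
  assumes S: "S \<subseteq> carrier G"
  shows "subgroup (centralizer G S) G"
proof (rule subgroupI)
  fix a assume a: "a \<in> centralizer G S"
  have "inv a \<otimes> s = s \<otimes> inv a" if "s \<in> S" for s
  proof -
    have "a \<in> carrier G" "s \<in> carrier G" "a \<otimes> s = s \<otimes> a"
      using a that S by (auto simp: centralizer_def)
    then show ?thesis
      by (metis inv_closed inv_solve_left inv_solve_right m_assoc m_closed)
  qed
  then show "inv a \<in> centralizer G S"
    using a by (simp add: centralizer_def)
next
  fix a b assume "a \<in> centralizer G S" "b \<in> centralizer G S"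
  then show "a \<otimes> b \<in> centralizer G S"
    using S by (auto simp: centralizer_def subset_iff) (metis m_assoc)
qed (use S in \<open>auto simp: centralizer_def intro!: exI[of _ \<one>]\<close>)

lemma (in group) centralizer_generate:
  assumes S: "S \<subseteq> carrier G"
  shows "centralizer G (generate G S) = centralizer G S"
proof
  show "centralizer G (generate G S) \<subseteq> centralizer G S"
    by (auto simp: centralizer_def intro: generate.incl)
  show "centralizer G S \<subseteq> centralizer G (generate G S)"
  proof
    fix g assume g: "g \<in> centralizer G S"
    then have "S \<subseteq> centralizer G {g}" "g \<in> carrier G"
      using S by (auto simp: centralizer_def)
    then have "generate G S \<subseteq> centralizer G {g}"
      using generate_subgroup_incl centralizer_subgroup by auto
    then show "g \<in> centralizer G (generate G S)"
      using \<open>g \<in> carrier G\<close> by (auto simp: centralizer_def)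
  qed
qed

lemma (in group) generate_singleton_subset_centralizer:
  assumes "z \<in> carrier G"
  shows "generate G {z} \<subseteq> centralizer G (generate G {z})"
proof (rule generate_subgroup_incl)
  show "subgroup (centralizer G (generate G {z})) G"
    using assms by (intro centralizer_subgroup generate_incl) simp
  show "{z} \<subseteq> centralizer G (generate G {z})"
    using assms by (simp add: centralizer_generate) (simp add: centralizer_def)
qed

lemma (in group) cyclic_group_subgroup:
  assumes cyclic: "cyclic_group G" and K: "subgroup K G"
  shows "cyclic_group (G\<lparr>carrier := K\<rparr>)"
proof -
  interpret K: subgroup K G by (rule K)
  interpret KG: group "G\<lparr>carrier := K\<rparr>"
    using K by (rule subgroup_imp_group)
  obtain x where x: "x \<in> carrier G" "carrier G = range (\<lambda>n::int. x [^] n)"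
    using cyclic cyclic_group by blast
  define I where "I = {n::int. x [^] n \<in> K}"
  have "i \<in> I" if "i \<in> group_closure I" for i
    using that by induction (auto simp: I_def int_pow_diff[OF x(1)])
  then have I: "I = range (times (Gcd I))"
    using group_closure.base unfolding group_closure_eq[symmetric] by blast
  have "K = (\<lambda>n. x [^] n) ` I"
    using K.subset x(2) by (auto simp: I_def)
  also have "\<dots> = range (\<lambda>n::int. (x [^] Gcd I) [^] n)"
    by (subst I) (simp add: image_image int_pow_pow[OF x(1)])
  finally have "K = range (\<lambda>n::int. (x [^] Gcd I) [^] n)" .
  moreover have gen: "x [^] Gcd I \<in> K"
    using I by (force simp: I_def)
  ultimately show ?thesis
    unfolding KG.cyclic_group using int_pow_consistent[OF K gen]
    by (intro bexI[of _ "x [^] Gcd I"]) auto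
qed

lemma (in group_hom) cyclic_FactGroup_kernel:
  assumes "cyclic_group H"
  shows "cyclic_group (G Mod kernel G H h)"
proof -
  let ?I = "H\<lparr>carrier := h ` carrier G\<rparr>"
  interpret I: group_hom G ?I h
    using induced_group_hom[OF G.subgroup_self] by simp
  have "cyclic_group ?I"
    using assms img_is_subgroup by (rule H.cyclic_group_subgroup)
  moreover have "G Mod kernel G H h \<cong> ?I"
    using I.FactGroup_iso by (simp add: kernel_def)
  moreover have "group (G Mod kernel G H h)"
    using normal_kernel by (rule normal.factorgroup_is_group)
  ultimately show ?thesis
    using isomorphic_group_cyclicity I.H.group_axioms by blast
qed

lemma (in field) cyclic_group_units_of:
  assumes "finite (carrier R)"
  shows "cyclic_group (units_of R)"
proof -
  interpret U: group "units_of R"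
    by (rule units_group)
  obtain a where a: "a \<in> carrier (units_of R)"
    and gen: "carrier (units_of R) = {a [^] i | i::nat. i \<in> UNIV}"
    using finite_field_mult_group_has_gen[OF assms] unfolding mult_of_is_Units by blast
  have "carrier (units_of R) = range (\<lambda>n::int. a [^]\<^bsub>units_of R\<^esub> n)"
  proof
    have "a [^] i = a [^]\<^bsub>units_of R\<^esub> int i" for i :: nat
      by (simp add: int_pow_int units_of_def nat_pow_def)
    then show "carrier (units_of R) \<subseteq> range (\<lambda>n::int. a [^]\<^bsub>units_of R\<^esub> n)"
      unfolding gen by blast
    show "range (\<lambda>n::int. a [^]\<^bsub>units_of R\<^esub> n) \<subseteq> carrier (units_of R)"
      using U.int_pow_closed[OF a] by blast
  qed
  then show ?thesis
    unfolding U.cyclic_group using a by blast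
qed

text \<open>Meaningful only if \<open>g\<close> normalizes the subgroup generated by \<open>z\<close>.\<close>

definition (in group) conj_exponent :: "'a \<Rightarrow> 'a \<Rightarrow> int"
  where "conj_exponent z g = (SOME k. g \<otimes> z \<otimes> inv g = z [^] k) mod int (ord z)"

lemma (in group) int_pow_eq_iff_mod_ord:
  fixes i j :: int
  assumes "z \<in> carrier G"
  shows "z [^] i = z [^] j \<longleftrightarrow> i mod int (ord z) = j mod int (ord z)"
  using assms by (metis int_pow_eq mod_eq_dvd_iff)

lemma (in group) conj_exponent_eqI:
  assumes "z \<in> carrier G" "g \<otimes> z \<otimes> inv g = z [^] k"
  shows "conj_exponent z g = k mod int (ord z)"
proof -
  have "z [^] (SOME k::int. g \<otimes> z \<otimes> inv g = z [^] k) = z [^] k"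
    using someI[of "\<lambda>k::int. g \<otimes> z \<otimes> inv g = z [^] k" k] assms(2) by simp
  then show ?thesis
    using int_pow_eq_iff_mod_ord[OF assms(1)] by (simp add: conj_exponent_def)
qed

lemma (in group) conj_eq_pow_conj_exponent:
  assumes z: "z \<in> carrier G" "generate G {z} \<lhd> G" and g: "g \<in> carrier G"
  shows "g \<otimes> z \<otimes> inv g = z [^] conj_exponent z g"
proof -
  have "g \<otimes> z \<otimes> inv g \<in> generate G {z}"
    using z(2) g by (rule normal.inv_op_closed2) (simp add: generate.incl)
  then obtain k :: int where k: "g \<otimes> z \<otimes> inv g = z [^] k"
    using generate_pow[OF z(1)] by blast
  then show ?thesis
    using conj_exponent_eqI[OF z(1) k] int_pow_eq_iff_mod_ord[OF z(1)] by simp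
qed

lemma (in group) conj_exponent_mult:
  assumes z: "z \<in> carrier G" "generate G {z} \<lhd> G" and gh: "g \<in> carrier G" "h \<in> carrier G"
  shows "conj_exponent z (g \<otimes> h) = conj_exponent z g * conj_exponent z h mod int (ord z)"
proof (rule conj_exponent_eqI[OF z(1)])
  interpret conj: group_hom G G "\<lambda>x. g \<otimes> x \<otimes> inv g"
    using gh(1) by (rule conjugation_group_hom)
  note conj_eq = conj_eq_pow_conj_exponent[OF z]
  have "g \<otimes> h \<otimes> z \<otimes> inv (g \<otimes> h) = g \<otimes> (h \<otimes> z \<otimes> inv h) \<otimes> inv g"
    using gh z(1) by (simp add: m_assoc inv_mult_group)
  also have "\<dots> = (g \<otimes> z \<otimes> inv g) [^] conj_exponent z h"
    unfolding conj_eq[OF gh(2)] by (rule conj.hom_int_pow[OF z(1)])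
  also have "\<dots> = z [^] (conj_exponent z g * conj_exponent z h)"
    unfolding conj_eq[OF gh(1)] by (rule int_pow_pow[OF z(1)])
  finally show "g \<otimes> h \<otimes> z \<otimes> inv (g \<otimes> h) = z [^] (conj_exponent z g * conj_exponent z h)" .
qed

lemma (in group) conj_exponent_eq_one_iff:
  assumes z: "z \<in> carrier G" "1 < ord z" "generate G {z} \<lhd> G" and g: "g \<in> carrier G"
  shows "conj_exponent z g = 1 \<longleftrightarrow> g \<in> centralizer G (generate G {z})"
proof -
  have "conj_exponent z g = 1 \<longleftrightarrow> g \<otimes> z \<otimes> inv g = z"
    using conj_exponent_eqI[OF z(1), of g 1] conj_eq_pow_conj_exponent[OF z(1,3) g] z(1,2) by auto
  also have "\<dots> \<longleftrightarrow> g \<otimes> z = z \<otimes> g"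
    using g z(1) by (metis inv_solve_right' m_closed)
  finally show ?thesis
    using z(1) g by (subst centralizer_generate) (auto simp: centralizer_def)
qed

lemma (in group) conj_exponent_hom_units:
  assumes z: "z \<in> carrier G" "1 < ord z" "generate G {z} \<lhd> G"
  defines "R \<equiv> residue_ring (int (ord z))"
  shows "group_hom G (units_of R) (conj_exponent z)"
    and "kernel G (units_of R) (conj_exponent z) = centralizer G (generate G {z})"
proof -
  interpret R: residues "int (ord z)" R
    using z(2) by (simp_all add: residues_def R_def)
  interpret R: cring R
    by (rule R.cring)
  have range: "conj_exponent z g \<in> carrier R" for g
    using z(2) by (simp add: conj_exponent_def R.res_carrier_eq)
  have mult: "conj_exponent z (g \<otimes> h) = conj_exponent z g \<otimes>\<^bsub>R\<^esub> conj_exponent z h"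
    if "g \<in> carrier G" "h \<in> carrier G" for g h
    using conj_exponent_mult[OF z(1,3) that] by (simp add: R.res_mult_eq)
  have "\<one> \<in> centralizer G (generate G {z})"
    using z(1) by (intro subgroup.one_closed centralizer_subgroup generate_incl) simp
  then have one: "conj_exponent z \<one> = \<one>\<^bsub>R\<^esub>"
    using conj_exponent_eq_one_iff[OF z] by (simp add: R.res_one_eq)
  have "conj_exponent z g \<in> Units R" if "g \<in> carrier G" for g
  proof -
    have "conj_exponent z g \<otimes>\<^bsub>R\<^esub> conj_exponent z (inv g) = \<one>\<^bsub>R\<^esub>"
      using that one mult[of g "inv g"] by simp
    then show ?thesis
      using range R.m_comm by (auto simp: Units_def intro!: bexI[of _ "conj_exponent z (inv g)"])
  qed
  then have "conj_exponent z \<in> hom G (units_of R)"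
    using mult by (intro homI) (auto simp: units_of_def)
  then show "group_hom G (units_of R) (conj_exponent z)"
    by (simp add: group_hom_def group_hom_axioms_def R.units_group)
  show "kernel G (units_of R) (conj_exponent z) = centralizer G (generate G {z})"
    using conj_exponent_eq_one_iff[OF z]
    by (auto simp: kernel_def units_of_one R.res_one_eq centralizer_def)
qed

lemma (in group) prime_order_subgroup_eq_generate:
  assumes N: "subgroup N G" and p: "Factorial_Ring.prime (card N)"
  shows "\<exists>z\<in>carrier G. N = generate G {z}"
proof -
  have "N \<noteq> {\<one>}"
    using p by auto
  then obtain z where z: "z \<in> N" "z \<noteq> \<one>"
    using subgroup.one_closed[OF N] by blast
  have z_carrier: "z \<in> carrier G"
    using N z(1) by (rule subgroup.mem_carrier)
  have sub: "generate G {z} \<subseteq> N"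
    using z(1) N by (intro generate_subgroup_incl) auto
  then have "card (generate G {z}) dvd card N"
    using N z_carrier by (intro card_subgroup_dvd generate_is_subgroup) auto
  moreover have "card (generate G {z}) \<noteq> 1"
    using z_carrier z(2) ord_eq_1 generate_pow_card by metis
  ultimately have "card (generate G {z}) = card N"
    using p by (auto simp: prime_nat_iff)
  then have "generate G {z} = N"
    using sub prime_gt_0_nat[OF p] by (intro card_subset_eq) (auto simp: card_gt_0_iff)
  then show ?thesis
    using z_carrier by blast
qed

lemma (in group) cyclic_FactGroup_centralizer:
  assumes N: "N \<lhd> G" and p: "Factorial_Ring.prime (card N)"
  shows "centralizer G N \<lhd> G" and "cyclic_group (G Mod centralizer G N)"
proof -
  let ?R = "residue_ring (int (card N))"
  interpret R: residues_prime "card N" ?R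
    using p by (simp add: residues_prime_def)
  obtain z where z: "z \<in> carrier G" "N = generate G {z}"
    using prime_order_subgroup_eq_generate[OF normal_imp_subgroup[OF N] p] by blast
  then have "ord z = card N"
    by (simp add: generate_pow_card)
  then have "group_hom G (units_of ?R) (conj_exponent z)"
    and ker: "kernel G (units_of ?R) (conj_exponent z) = centralizer G N"
    using conj_exponent_hom_units[OF z(1)] N z(2) prime_gt_1_nat[OF p] by auto
  then interpret \<chi>: group_hom G "units_of ?R" "conj_exponent z"
    by simp
  show "centralizer G N \<lhd> G"
    using \<chi>.normal_kernel by (simp only: ker)
  show "cyclic_group (G Mod centralizer G N)"
    using \<chi>.cyclic_FactGroup_kernel[OF R.cyclic_group_units_of] by (simp add: ker)
qed

section \<open>Supersoluble groups\<close>

lemma (in group) supersoluble_if_cyclic_by_cyclic: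
  assumes N: "N \<lhd> G" and cyclic: "cyclic_group (G\<lparr>carrier := N\<rparr>)" "cyclic_group (G Mod N)"
  shows "supersoluble G"
proof -
  interpret N: normal N G by (rule N)
  interpret NG: group "G\<lparr>carrier := N\<rparr>"
    using N.subgroup_axioms by (rule subgroup_imp_group)
  have "group (G\<lparr>carrier := N\<rparr> Mod {\<one>})"
    using NG.one_is_normal normal.factorgroup_is_group by force
  then have "cyclic_group (G\<lparr>carrier := N\<rparr> Mod {\<one>})"
    using isomorphic_group_cyclicity[OF is_isoI[OF NG.trivial_factor_iso]] NG.group_axioms cyclic(1)
    by simp
  then show ?thesis
    unfolding supersoluble_def
    using cyclic(2) one_is_normal N normal_self N.one_closed N.subset group_axioms
    by (intro conjI exI[of _ "[{\<one>}, N, carrier G]"]) (auto simp: less_Suc_eq nth_Cons')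
qed

lemma FactGroup_restrict_iso_image:
  assumes f: "f \<in> iso G K" and G: "group G" and K: "group K"
    and B: "subgroup B G" and A: "A \<lhd> G\<lparr>carrier := B\<rparr>"
  shows "f ` A \<lhd> K\<lparr>carrier := f ` B\<rparr>"
    and "G\<lparr>carrier := B\<rparr> Mod A \<cong> K\<lparr>carrier := f ` B\<rparr> Mod f ` A"
proof -
  have "restrict f B ` A = f ` A"
    using subgroup.subset[OF normal_imp_subgroup[OF A]] by auto
  moreover have "subgroup (f ` B) K"
    using B G K f by (rule subgroup.iso_subgroup)
  ultimately show "f ` A \<lhd> K\<lparr>carrier := f ` B\<rparr>"
    and "G\<lparr>carrier := B\<rparr> Mod A \<cong> K\<lparr>carrier := f ` B\<rparr> Mod f ` A"
    using FactGroup_iso_image[OF iso_restrict[OF f G K B] _ _ A] B G K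
    by (auto simp: group.subgroup_imp_group)
qed

lemma supersoluble_iso:
  assumes G: "supersoluble G" and f: "f \<in> iso G K" and K: "group K"
  shows "supersoluble K"
proof -
  have G_group: "group G"
    using G by (simp add: supersoluble_def)
  obtain Ns where Ns: "Ns \<noteq> []" "hd Ns = {\<one>\<^bsub>G\<^esub>}" "last Ns = carrier G"
    and normal: "\<And>N. N \<in> set Ns \<Longrightarrow> N \<lhd> G"
    and mono: "\<And>i. Suc i < length Ns \<Longrightarrow> Ns ! i \<subseteq> Ns ! Suc i"
    and cyclic: "\<And>i. Suc i < length Ns \<Longrightarrow> cyclic_group (G\<lparr>carrier := Ns ! Suc i\<rparr> Mod (Ns ! i))"
    using G unfolding supersoluble_def by blast
  have "cyclic_group (K\<lparr>carrier := f ` (Ns ! Suc i)\<rparr> Mod f ` (Ns ! i))" if i: "Suc i < length Ns" for i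
  proof -
    have "Ns ! i \<lhd> G" and B: "subgroup (Ns ! Suc i) G"
      using normal i by (simp_all add: Suc_lessD normal_imp_subgroup)
    then have A: "Ns ! i \<lhd> G\<lparr>carrier := Ns ! Suc i\<rparr>"
      using mono[OF i] by (intro group.normal_restrict_supergroup[OF G_group])
    show ?thesis
      using cyclic[OF i] FactGroup_restrict_iso_image[OF f G_group K B A]
        isomorphic_group_cyclicity A by (metis normal.factorgroup_is_group)
  qed
  moreover have "f \<one>\<^bsub>G\<^esub> = \<one>\<^bsub>K\<^esub>" "f ` carrier G = carrier K"
    using f G_group K hom_one by (auto simp: iso_def bij_betw_def)
  moreover have "f ` N \<lhd> K" if "N \<in> set Ns" for N
    using f G_group K normal[OF that] by (rule iso_normal_subgroup)
  ultimately show ?thesis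
    unfolding supersoluble_def using K Ns mono
    by (intro conjI exI[of _ "map ((`) f) Ns"]) (simp_all add: hd_map last_map image_mono)
qed

lemma (in group) supersoluble_FactGroup_if_cyclic_by_cyclic:
  assumes L: "L \<lhd> G" and N: "subgroup N G" "cyclic_group (G\<lparr>carrier := N\<rparr>)"
    and NL: "N <#> L \<lhd> G" "cyclic_group (G Mod (N <#> L))"
  shows "supersoluble (G Mod L)"
proof -
  interpret L: normal L G by (rule L)
  interpret N: subgroup N G by (rule N(1))
  interpret h: group_hom G "G Mod L" "\<lambda>x. L #> x"
    by (rule L.rcos_group_hom)
  let ?N = "(\<lambda>x. L #> x) ` N"
  have "x \<in> N <#> L" if "x \<in> L" for x
    unfolding set_mult_def using that N.one_closed by (intro UN_I[of \<one>] UN_I[of x]) simp_all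
  then have "kernel G (G Mod L) (\<lambda>x. L #> x) \<subseteq> N <#> L"
    by (auto simp only: L.kernel_rcos)
  moreover have "(\<lambda>x. L #> x) ` (N <#> L) = ?N"
    using h.set_mult_ker_hom(1)[OF N.subset] by (simp add: L.kernel_rcos)
  ultimately have image_FactGroup: "?N \<lhd> G Mod L" "G Mod (N <#> L) \<cong> (G Mod L) Mod ?N"
    using h.FactGroup_image_iso[OF carrier_FactGroup[symmetric] NL(1)] by simp_all
  interpret r: group_hom "G\<lparr>carrier := N\<rparr>" "(G Mod L)\<lparr>carrier := ?N\<rparr>" "\<lambda>x. L #> x"
    using N(1) by (rule h.induced_group_hom)
  have "(\<lambda>x. L #> x) \<in> epi (G\<lparr>carrier := N\<rparr>) ((G Mod L)\<lparr>carrier := ?N\<rparr>)"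
    using r.homh by (simp add: epi_def)
  then have "cyclic_group ((G Mod L)\<lparr>carrier := ?N\<rparr>)"
    using N(2) r.G.cyclic_group_epimorphic_image r.H.group_axioms by blast
  moreover have "cyclic_group ((G Mod L) Mod ?N)"
    using isomorphic_group_cyclicity[OF image_FactGroup(2) normal.factorgroup_is_group[OF NL(1)]
        normal.factorgroup_is_group[OF image_FactGroup(1)]] NL(2) by blast
  ultimately show ?thesis
    using image_FactGroup(1) by (intro h.H.supersoluble_if_cyclic_by_cyclic)
qed

lemma (in group) normal_Int_if_commuting:
  assumes C: "C \<lhd> G" and M: "subgroup M G" and N: "N \<subseteq> carrier G" "N <#> M = carrier G"
    and commute: "\<And>n c. n \<in> N \<Longrightarrow> c \<in> C \<Longrightarrow> n \<otimes> c = c \<otimes> n"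
  shows "C \<inter> M \<lhd> G"
proof (rule normal_invI)
  interpret C: normal C G by (rule C)
  interpret M: subgroup M G by (rule M)
  show "subgroup (C \<inter> M) G"
    using C.subgroup_axioms M by (rule subgroups_Inter_pair)
  fix x c assume "x \<in> carrier G" and c: "c \<in> C \<inter> M"
  then have "x \<in> N <#> M"
    by (simp only: N(2))
  then obtain n m where nm: "n \<in> N" "m \<in> M" "x = n \<otimes> m"
    by (auto simp: set_mult_def)
  define y where "y = m \<otimes> c \<otimes> inv m"
  have y: "y \<in> C \<inter> M"
    unfolding y_def using nm(2) c C.inv_op_closed2 by auto
  have "x \<otimes> c \<otimes> inv x = n \<otimes> y \<otimes> inv n"
    using nm c N(1) by (auto simp: y_def m_assoc inv_mult_group subset_iff)
  also have "\<dots> = y"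
    using commute[OF nm(1)] y nm(1) N(1) by (auto simp: m_assoc subset_iff)
  finally show "x \<otimes> c \<otimes> inv x \<in> C \<inter> M"
    using y by simp
qed

lemma (in group) supersoluble_FactGroup_centralizer_Int:
  assumes N: "N \<lhd> G" "Factorial_Ring.prime (card N)"
    and M: "subgroup M G" "N <#> M = carrier G"
  shows "centralizer G N \<inter> M \<lhd> G" and "supersoluble (G Mod (centralizer G N \<inter> M))"
proof -
  interpret N: normal N G by (rule N(1))
  interpret C: normal "centralizer G N" G
    using N by (rule cyclic_FactGroup_centralizer)
  obtain z where z: "z \<in> carrier G" "N = generate G {z}"
    using prime_order_subgroup_eq_generate[OF N.subgroup_axioms N(2)] by blast
  then have N_cyclic: "cyclic_group (G\<lparr>carrier := N\<rparr>)"
    using cyclic_group_generated[of z] by (simp add: subgroup_generated_def)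
  have N_le: "N \<subseteq> centralizer G N"
    using z generate_singleton_subset_centralizer by simp
  show L: "centralizer G N \<inter> M \<lhd> G"
    using C.normal_axioms M(1) N.subset M(2)
    by (rule normal_Int_if_commuting) (auto dest: centralizerD)
  have "N <#> (centralizer G N \<inter> M) = centralizer G N"
    using modular_law[OF C.subgroup_axioms N_le subgroup.subset[OF M(1)]] M(2) C.subset by blast
  then show "supersoluble (G Mod (centralizer G N \<inter> M))"
    using C.normal_axioms cyclic_FactGroup_centralizer(2)[OF N]
    by (intro supersoluble_FactGroup_if_cyclic_by_cyclic[OF L N.subgroup_axioms N_cyclic]) simp_all
qed

section \<open>Formations\<close>

lemma (in group) ex_iso_nat_monoid:
  assumes "finite (carrier G)"
  shows "\<exists>(Y :: nat monoid) f. group Y \<and> finite (carrier Y) \<and> f \<in> iso G Y"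
proof -
  obtain f :: "'a \<Rightarrow> nat" where f: "inj_on f (carrier G)"
    using assms finite_imp_inj_to_nat_seg by blast
  have "finite (carrier (image_group f G))"
    using assms by (simp add: image_group_carrier)
  then show ?thesis
    using inj_imp_image_group_is_group[OF f] inj_imp_image_group_iso[OF f] by blast
qed

lemma in_class_iso:
  assumes G: "in_class F G" and iso: "G \<cong> K" and K: "group K"
  shows "in_class F K"
proof -
  obtain Y where Y: "F Y" "group Y" "finite (carrier Y)" "G \<cong> Y"
    using G by (auto simp: in_class_def)
  have "group G" "finite (carrier G)"
    using G by (simp_all add: in_class_def)
  then have "K \<cong> Y" "finite (carrier K)"
    using iso Y(4) iso_trans[OF group.iso_sym] iso_finite by blast+
  then show ?thesis
    using Y K by (auto simp: in_class_def)
qed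

lemma in_class_if_supersoluble:
  assumes contains_supersoluble: "\<forall>K :: nat monoid. group K \<and> finite (carrier K) \<and> supersoluble K \<longrightarrow> in_class F K"
    and G: "supersoluble G" "finite (carrier G)"
  shows "in_class F G"
proof -
  interpret group G
    using G(1) by (simp add: supersoluble_def)
  obtain Y :: "nat monoid" and f where Y: "group Y" "finite (carrier Y)" and f: "f \<in> iso G Y"
    using ex_iso_nat_monoid[OF G(2)] by blast
  have "in_class F Y"
    using contains_supersoluble Y supersoluble_iso[OF G(1) f Y(1)] by blast
  then show ?thesis
    using iso_sym[OF is_isoI[OF f]] group_axioms by (rule in_class_iso)
qed

lemma in_class_FactGroup_iso_iff:
  assumes f: "f \<in> iso G Y" and G: "group G" and Y: "group Y" and N: "N \<lhd> G"
  shows "in_class F (Y Mod f ` N) \<longleftrightarrow> in_class F (G Mod N)"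
proof -
  note image_FactGroup = FactGroup_iso_image[OF assms]
  have groups: "group (G Mod N)" "group (Y Mod f ` N)"
    using N image_FactGroup(1) by (simp_all add: normal.factorgroup_is_group)
  show ?thesis
    using image_FactGroup(2) groups in_class_iso group.iso_sym by metis
qed

lemma formation_FactGroup:
  assumes F: "formation F" and G: "in_class F G" and N: "N \<lhd> G"
  shows "in_class F (G Mod N)"
proof -
  interpret group G
    using G by (simp add: in_class_def)
  obtain Y :: "nat monoid" and f where Y: "group Y" "finite (carrier Y)" and f: "f \<in> iso G Y"
    using ex_iso_nat_monoid G by (auto simp: in_class_def)
  have "in_class F Y"
    using G is_isoI[OF f] Y(1) by (rule in_class_iso)
  then have "in_class F (Y Mod f ` N)"
    using F Y iso_normal_subgroup[OF f group_axioms Y(1) N] unfolding formation_def by blast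
  then show ?thesis
    by (simp add: in_class_FactGroup_iso_iff[OF f group_axioms Y(1) N])
qed

lemma formation_FactGroup_mono:
  assumes F: "formation F" and G: "group G"
    and N: "N \<lhd> G" "in_class F (G Mod N)" and K: "K \<lhd> G" "N \<subseteq> K"
  shows "in_class F (G Mod K)"
proof -
  interpret N: normal N G by (rule N(1))
  interpret h: group_hom G "G Mod N" "\<lambda>x. N #>\<^bsub>G\<^esub> x"
    by (rule N.rcos_group_hom)
  let ?K = "(\<lambda>x. N #>\<^bsub>G\<^esub> x) ` K"
  have K': "?K \<lhd> G Mod N" "G Mod K \<cong> (G Mod N) Mod ?K"
    using h.FactGroup_image_iso[OF carrier_FactGroup[symmetric] K(1)] K(2)
    by (simp_all add: N.kernel_rcos)
  have K_quot: "group (G Mod K)"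
    using K(1) by (rule normal.factorgroup_is_group)
  have "in_class F ((G Mod N) Mod ?K)"
    using F N(2) K'(1) by (rule formation_FactGroup)
  then show ?thesis
    using group.iso_sym[OF K_quot K'(2)] K_quot by (rule in_class_iso)
qed

lemma formation_FactGroup_Int:
  assumes F: "formation F" and G: "group G" "finite (carrier G)"
    and N: "N1 \<lhd> G" "N2 \<lhd> G" "in_class F (G Mod N1)" "in_class F (G Mod N2)"
  shows "in_class F (G Mod (N1 \<inter> N2))"
proof -
  interpret group G by (rule G(1))
  obtain Y :: "nat monoid" and f where Y: "group Y" "finite (carrier Y)" and f: "f \<in> iso G Y"
    using ex_iso_nat_monoid[OF G(2)] by blast
  note iff = in_class_FactGroup_iso_iff[OF f G(1) Y(1)]
  have "f ` (N1 \<inter> N2) = f ` N1 \<inter> f ` N2"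
    using f N(1,2) by (intro inj_on_image_Int[of _ "carrier G"])
      (auto simp: iso_def bij_betw_def dest: normal_imp_subgroup subgroup.subset)
  moreover have "in_class F (Y Mod (f ` N1 \<inter> f ` N2))"
    using F Y iso_normal_subgroup[OF f G(1) Y(1)] N iff[OF N(1)] iff[OF N(2)]
    unfolding formation_def by blast
  ultimately show ?thesis
    using iff[OF normal_subgroup_intersect[OF N(1,2)]] by simp
qed

lemma saturated_formation_FactGroup_frattini:
  assumes F: "saturated_formation F" and G: "group G" "finite (carrier G)"
    and quot: "in_class F (G Mod frattini G)"
  shows "in_class F G"
proof -
  interpret group G by (rule G(1))
  obtain Y :: "nat monoid" and f where Y: "group Y" "finite (carrier Y)" and f: "f \<in> iso G Y"
    using ex_iso_nat_monoid[OF G(2)] by blast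
  have "in_class F (Y Mod frattini Y)"
    using quot in_class_FactGroup_iso_iff[OF f G(1) Y(1) frattini_normal]
    by (simp add: frattini_iso_image[OF f G(1) Y(1)])
  then have "in_class F Y"
    using F Y unfolding saturated_formation_def by blast
  then show ?thesis
    using iso_sym[OF is_isoI[OF f]] G(1) by (rule in_class_iso)
qed

lemma in_class_if_minimal_normal_separated:
  assumes F: "formation F" and G: "group G" "finite (carrier G)"
    and H: "H \<lhd> G" "in_class F (G Mod H)"
    and separated: "\<And>N. minimal_normal N G \<Longrightarrow> N \<subseteq> H \<Longrightarrow>
        \<exists>L. L \<lhd> G \<and> in_class F (G Mod L) \<and> \<not> N \<subseteq> L"
  shows "in_class F G"
proof -
  interpret group G by (rule G(1))
  let ?P = "\<lambda>K. K \<lhd> G \<and> K \<subseteq> H \<and> in_class F (G Mod K)"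
  obtain K where K: "?P K" and least: "\<And>K'. ?P K' \<Longrightarrow> card K \<le> card K'"
    using ex_has_least_nat[of ?P H card] H by blast
  have "K = {\<one>\<^bsub>G\<^esub>}"
  proof (rule ccontr)
    assume "K \<noteq> {\<one>\<^bsub>G\<^esub>}"
    then obtain N where N: "minimal_normal N G" "N \<subseteq> K"
      using ex_minimal_normal_subset[OF G(2)] K by blast
    then obtain L where L: "L \<lhd> G" "in_class F (G Mod L)" "\<not> N \<subseteq> L"
      using separated[of N] K by blast
    have "?P (K \<inter> L)"
      using formation_FactGroup_Int[OF F G _ L(1) _ L(2)] normal_subgroup_intersect[OF _ L(1)] K
      by blast
    then have "card K \<le> card (K \<inter> L)"
      by (rule least)
    moreover have "finite K"
      using K finite_subset[OF subgroup.subset[OF normal_imp_subgroup] G(2)] by blast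
    ultimately have "K \<inter> L = K"
      by (metis card_seteq inf_le1)
    then show False
      using L(3) N(2) by blast
  qed
  then have "in_class F (G Mod {\<one>\<^bsub>G\<^esub>})"
    using K by simp
  then show ?thesis
    using is_isoI[OF trivial_factor_iso] G(1) by (rule in_class_iso)
qed

lemma in_class_if_frattini_Int_trivial:
  assumes F: "formation F"
    and contains_supersoluble: "\<forall>K :: nat monoid. group K \<and> finite (carrier K) \<and> supersoluble K \<longrightarrow> in_class F K"
    and G: "group G" "finite (carrier G)" and H: "H \<lhd> G" "in_class F (G Mod H)"
    and trivial: "frattini G \<inter> H = {\<one>\<^bsub>G\<^esub>}"
    and index: "\<And>N M. minimal_normal N G \<Longrightarrow> N \<subseteq> H \<Longrightarrow> maximal_subgroup M G \<Longrightarrow> \<not> N \<subseteq> M \<Longrightarrow>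
        Factorial_Ring.prime (card (rcosets\<^bsub>G\<^esub> M))"
  shows "in_class F G"
  using F G H
proof (rule in_class_if_minimal_normal_separated)
  interpret group G by (rule G(1))
  fix N assume N: "minimal_normal N G" "N \<subseteq> H"
  have N_normal: "N \<lhd> G"
    using N(1) by (rule minimal_normal_imp_normal)
  have "\<not> N \<subseteq> frattini G"
    using N trivial subgroup.one_closed[OF normal_imp_subgroup[OF N_normal]]
    by (auto simp: minimal_normal_def)
  then obtain M where M: "maximal_subgroup M G" "\<not> N \<subseteq> M"
    using minimal_normal_subset_carrier[OF N(1)] by (auto simp: frattini_def)
  have "Factorial_Ring.prime (card N)"
    using G(2) N(1) index[OF N] M by (rule minimal_normal_prime_order)
  then have L: "centralizer G N \<inter> M \<lhd> G" "supersoluble (G Mod (centralizer G N \<inter> M))"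
    using supersoluble_FactGroup_centralizer_Int[OF N_normal] M
      normal_mult_maximal_eq_carrier[OF N_normal M] maximal_subgroup_imp_subgroup by blast+
  have "in_class F (G Mod (centralizer G N \<inter> M))"
    using contains_supersoluble L(2) by (rule in_class_if_supersoluble) (simp add: carrier_FactGroup G(2))
  then show "\<exists>L. L \<lhd> G \<and> in_class F (G Mod L) \<and> \<not> N \<subseteq> L"
    using L(1) M(2) by blast
qed

section \<open>Reduction modulo the Frattini subgroup of a normal subgroup\<close>

lemma (in group) prime_index_if_normal_not_subset:
  assumes fin: "finite (carrier G)" and T: "T \<lhd> G" and M: "maximal_subgroup M G" "\<not> T \<subseteq> M"
    and index: "card T div card (T \<inter> M) = 1 \<or> Factorial_Ring.prime (card T div card (T \<inter> M))"
  shows "Factorial_Ring.prime (card (rcosets M))"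
proof -
  interpret T: normal T G by (rule T)
  have M_sub: "subgroup M G"
    using M(1) by (rule maximal_subgroup_imp_subgroup)
  have card_T: "card T = card (rcosets M) * card (T \<inter> M)"
    using fin T M_sub normal_mult_maximal_eq_carrier[OF T M] by (rule card_normal_eq_index_mult)
  have "finite T"
    using T.subset fin by (rule finite_subset)
  then have "card (rcosets M) \<noteq> 1"
    using card_T M(2) by (metis card_subset_eq inf_le1 le_iff_inf mult_1)
  moreover have "card (T \<inter> M) > 0"
    using subgroups_Inter_pair[OF T.subgroup_axioms M_sub] fin
    by (rule subgroup.finite_imp_card_positive)
  ultimately show ?thesis
    using index card_T by simp
qed

lemma FactGroup_restrict_carrier:
  "G\<lparr>carrier := H\<rparr> Mod P = (G Mod P)\<lparr>carrier := (\<lambda>x. P #>\<^bsub>G\<^esub> x) ` H\<rparr>"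
proof -
  have "set_mult (G\<lparr>carrier := H\<rparr>) = set_mult G"
    by (intro ext) simp
  then show ?thesis
    by (auto simp: FactGroup_def RCOSETS_def)
qed

locale normal_mod_frattini = normal +
  fixes P
  defines "P \<equiv> frattini (G\<lparr>carrier := H\<rparr>)"
  assumes finite_carrier: "finite (carrier G)"
begin

lemma P_subset_frattini: "P \<subseteq> frattini G"
  unfolding P_def using finite_carrier by (rule frattini_mono)

lemma P_subset: "P \<subseteq> H"
  by (auto simp: P_def frattini_def)

sublocale P: normal P G
  unfolding P_def by (rule normal_frattini)

sublocale quot: group_hom G "G Mod P" "\<lambda>x. P #> x"
  by (rule P.rcos_group_hom)

abbreviation H_mod_P where "H_mod_P \<equiv> (\<lambda>x. P #> x) ` H"

lemma H_mod_P_normal: "H_mod_P \<lhd> G Mod P"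
  and FactGroup_H_mod_P_iso: "G Mod H \<cong> (G Mod P) Mod H_mod_P"
  using quot.FactGroup_image_iso[OF carrier_FactGroup[symmetric] normal_axioms] P_subset
  by (simp_all add: P.kernel_rcos)

lemma frattini_FactGroup_Int:
  assumes "frattini G \<inter> H \<subseteq> P"
  shows "frattini (G Mod P) \<inter> H_mod_P = {\<one>\<^bsub>G Mod P\<^esub>}"
proof -
  have frattini: "frattini (G Mod P) = (\<lambda>x. P #> x) ` frattini G"
    using carrier_FactGroup[symmetric] P_subset_frattini
    by (intro quot.frattini_image) (simp_all add: P.kernel_rcos)
  have "frattini (G Mod P) \<inter> H_mod_P \<subseteq> {P}"
  proof
    fix C assume C: "C \<in> frattini (G Mod P) \<inter> H_mod_P"
    then obtain x y where x: "x \<in> frattini G" "C = P #> x" and y: "y \<in> H" "C = P #> y"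
      unfolding frattini by blast
    have "x \<in> {x \<in> carrier G. P #> x \<in> H_mod_P}"
      using x y by (auto simp: frattini_def)
    then have "x \<in> H"
      using quot.vimage_image_eq[OF subgroup_axioms] P_subset by (simp add: P.kernel_rcos)
    then have "x \<in> P"
      using assms x(1) by blast
    then show "C \<in> {P}"
      using x(2) coset_join2[OF P.mem_carrier P.subgroup_axioms] by simp
  qed
  moreover have "\<one>\<^bsub>G Mod P\<^esub> \<in> frattini (G Mod P) \<inter> H_mod_P"
    using subgroup.one_closed[OF quot.H.frattini_subgroup]
      subgroup.one_closed[OF normal_imp_subgroup[OF H_mod_P_normal]] by blast
  ultimately show ?thesis
    by auto
qed

lemma gen_fitting_tilde_eq:
  "gen_fitting_tilde (G\<lparr>carrier := H\<rparr>)
    = {x \<in> carrier G. P #> x \<in> socle ((G Mod P)\<lparr>carrier := H_mod_P\<rparr>)}"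
proof -
  let ?S = "socle ((G Mod P)\<lparr>carrier := H_mod_P\<rparr>)"
  have "?S \<subseteq> H_mod_P"
    using group.socle_subgroup[OF quot.H.subgroup_imp_group[OF normal_imp_subgroup[OF H_mod_P_normal]]]
      subgroup.subset by fastforce
  then have "{x \<in> carrier G. P #> x \<in> ?S} \<subseteq> H"
    using quot.vimage_image_eq[OF subgroup_axioms] P_subset by (auto simp: P.kernel_rcos)
  moreover have "gen_fitting_tilde (G\<lparr>carrier := H\<rparr>) = {x \<in> H. P #> x \<in> ?S}"
    by (simp add: gen_fitting_tilde_def FactGroup_restrict_carrier P_def)
  ultimately show ?thesis
    using subset by blast
qed

lemma gen_fitting_tilde_normal: "gen_fitting_tilde (G\<lparr>carrier := H\<rparr>) \<lhd> G"
proof -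
  have "socle ((G Mod P)\<lparr>carrier := H_mod_P\<rparr>) \<lhd> G Mod P"
    using H_mod_P_normal by (rule normal.normal_socle)
  then show ?thesis
    using P.factgroup_subgroup_union_normal P.factgroup_subgroup_union_char
    by (simp add: gen_fitting_tilde_eq normal_imp_subgroup)
qed

lemma prime_index_FactGroup:
  assumes index: "\<And>M. maximal_subgroup M G \<Longrightarrow> (let T = gen_fitting_tilde (G\<lparr>carrier := H\<rparr>) in
      card T div card (T \<inter> M) = 1 \<or> Factorial_Ring.prime (card T div card (T \<inter> M)))"
    and N: "minimal_normal N (G Mod P)" "N \<subseteq> H_mod_P"
    and M: "maximal_subgroup M (G Mod P)" "\<not> N \<subseteq> M"
  shows "Factorial_Ring.prime (card (rcosets\<^bsub>G Mod P\<^esub> M))"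
proof -
  let ?V = "{x \<in> carrier G. P #> x \<in> M}"
  note surj = carrier_FactGroup[symmetric]
  have M_sub: "subgroup M (G Mod P)"
    using M(1) by (rule maximal_subgroup_imp_subgroup)
  have V: "maximal_subgroup ?V G"
    using M(1) quot.maximal_subgroup_vimage_iff[OF surj M_sub] by simp
  have "N \<subseteq> socle ((G Mod P)\<lparr>carrier := H_mod_P\<rparr>)"
    using finite_carrier N
    by (intro normal.minimal_normal_subset_socle_normal[OF H_mod_P_normal]) (simp_all add: carrier_FactGroup)
  then have "\<not> gen_fitting_tilde (G\<lparr>carrier := H\<rparr>) \<subseteq> ?V"
    using M(2) minimal_normal_subset_carrier[OF N(1)]
    by (fastforce simp: gen_fitting_tilde_eq carrier_FactGroup)
  then have "Factorial_Ring.prime (card (rcosets ?V))"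
    using index[OF V] prime_index_if_normal_not_subset[OF finite_carrier gen_fitting_tilde_normal V]
    by (simp add: Let_def)
  then show ?thesis
    using quot.card_rcosets_vimage[OF finite_carrier surj M_sub] by simp
qed

end

theorem theorem2:
  fixes F :: "nat monoid \<Rightarrow> bool" and G :: "('a, 'b) monoid_scheme" and H :: "'a set"
  assumes "saturated_formation F"
    and "\<forall>K :: nat monoid. group K \<and> finite (carrier K) \<and> supersoluble K \<longrightarrow> in_class F K"
    and "group G" and "finite (carrier G)"
    and "H \<lhd> G"
    and "in_class F (G Mod H)"
    and "frattini G \<inter> H \<subseteq> frattini (G\<lparr>carrier := H\<rparr>)"
    and "\<forall>M. maximal_subgroup M G \<longrightarrow>
           (let T = gen_fitting_tilde (G\<lparr>carrier := H\<rparr>) in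
              card T div card (T \<inter> M) = 1 \<or> Factorial_Ring.prime (card T div card (T \<inter> M)))"
  shows "in_class F G"
proof -
  let ?P = "frattini (G\<lparr>carrier := H\<rparr>)"
  interpret normal_mod_frattini H G ?P
    using assms(4,5) by (simp add: normal_mod_frattini_def normal_mod_frattini_axioms_def)
  have F: "formation F"
    using assms(1) by (simp add: saturated_formation_def)
  have fin: "finite (carrier (G Mod ?P))"
    using assms(4) by (simp add: carrier_FactGroup)
  have "in_class F ((G Mod ?P) Mod H_mod_P)"
    using assms(6) FactGroup_H_mod_P_iso normal.factorgroup_is_group[OF H_mod_P_normal]
    by (rule in_class_iso)
  moreover have "frattini (G Mod ?P) \<inter> H_mod_P = {\<one>\<^bsub>G Mod ?P\<^esub>}"
    using assms(7) by (rule frattini_FactGroup_Int)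
  moreover note prime_index_FactGroup[OF assms(8)[rule_format]]
  ultimately have "in_class F (G Mod ?P)"
    by (rule in_class_if_frattini_Int_trivial[OF F assms(2) quot.H.group_axioms fin H_mod_P_normal])
  then have "in_class F (G Mod frattini G)"
    using frattini_normal P_subset_frattini
    by (rule formation_FactGroup_mono[OF F assms(3) P.normal_axioms])
  with assms(1,3,4) show ?thesis
    by (rule saturated_formation_FactGroup_frattini)
qed

end
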